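(* Let $G$ be a two-player stage game and consider the mixed-mixed regime. There exist a positive integer $T$ and an SPE of $G(T)$ in which locally suboptimal behavior occurs if and only if at least one of the following holds: (1) $|V_1^{m,m}|>1$, $|V_2^{m,m}|>1$, and there exist $\hat\sigma_1\in\Delta A_1,\hat\sigma_2\in\Delta A_2$ with $(\hat\sigma_1,\hat\sigma_2)\notin\mathrm{Nash}^{m,m}(G)$; (2) $|V_1^{m,m}|>1$, $|V_2^{m,m}|=1$, and there exist $\hat\sigma_1\in\Delta A_1$, $\hat\sigma_2\in\Delta A_2$, $a_1'\in A_1$ with $u_1(\hat\sigma_1,\hat\sigma_2)<u_1(a_1',\hat\sigma_2)$ and $\hat\sigma_2$ a best response to $\hat\sigma_1$; (3) $|V_1^{m,m}|=1$, $|V_2^{m,m}|>1$, and there exist $\hat\sigma_1\in\Delta A_1$, $\hat\sigma_2\in\Delta A_2$, $a_2'\in A_2$ with $u_2(\hat\sigma_1,\hat\sigma_2)<u_2(\hat\sigma_1,a_2')$ and $\hat\sigma_1$ a best response to $\hat\sigma_2$.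
   Context: A two-player stage game $G$ consists of finite nonempty action sets $A_1,A_2$ and payoff functions $u_1,u_2:A_1\times A_2\to\mathbb{R}$, extended to mixed strategies $\sigma_i\in\Delta A_i$ by expectation. A strategy is a best response to the opponent's strategy if it maximizes expected payoff against it. For an integer $T\ge1$, $G(T)$ is the $T$-round repetition of $G$ in which after each round both realized actions are observed and each player's payoff is the expected sum of stage payoffs over the $T$ rounds. In the mixed-mixed regime a strategy of player $i$ in $G(T)$ is a behavior strategy $\mu_i:\bigcup_{k=0}^{T-1}(A_1\times A_2)^k\to\Delta A_i$. A profile $\mu$ is a subgame-perfect equilibrium (SPE) if for every $0\le k<T$ and every history $h$ of length $k$, the continuation profile $\mu_{|h}$ (with $\mu_{i|h}(h')=\mu_i(h,h')$) is a Nash equilibrium of $G(T-k)$. $\mathrm{Nash}^{m,m}(G)$ is the set of mixed Nash equilibria of $G$ and $V_i^{m,m}=\{u_i(\sigma):\sigma\in\mathrm{Nash}^{m,m}(G)\}$. Locally suboptimal behavior occurs in an SPE $\mu$ of $G(T)$ if there exist $0\le k<T$ and a history $h$ of length $k$ with $(\mu_1(h),\mu_2(h))\notin\mathrm{Nash}^{m,m}(G)$. *)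

theory Defs
  imports "HOL-Probability.Probability_Mass_Function"
begin

definition mixed_payoff :: "('a::finite \<Rightarrow> 'b::finite \<Rightarrow> real) \<Rightarrow> 'a pmf \<Rightarrow> 'b pmf \<Rightarrow> real" where
  "mixed_payoff u s1 s2 = (\<Sum>a1\<in>UNIV. \<Sum>a2\<in>UNIV. pmf s1 a1 * pmf s2 a2 * u a1 a2)"

definition stage_nash ::
  "('a::finite \<Rightarrow> 'b::finite \<Rightarrow> real) \<Rightarrow> ('a \<Rightarrow> 'b \<Rightarrow> real) \<Rightarrow> 'a pmf \<Rightarrow> 'b pmf \<Rightarrow> bool" where
  "stage_nash u1 u2 s1 s2 \<longleftrightarrow>
     (\<forall>s1'. mixed_payoff u1 s1' s2 \<le> mixed_payoff u1 s1 s2) \<and>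
     (\<forall>s2'. mixed_payoff u2 s1 s2' \<le> mixed_payoff u2 s1 s2)"

definition nash_values ::
  "('a::finite \<Rightarrow> 'b::finite \<Rightarrow> real) \<Rightarrow> ('a \<Rightarrow> 'b \<Rightarrow> real) \<Rightarrow> ('a \<Rightarrow> 'b \<Rightarrow> real) \<Rightarrow> real set" where
  "nash_values u1 u2 u = {mixed_payoff u s1 s2 | s1 s2. stage_nash u1 u2 s1 s2}"

text \<open>Behavior strategies in the repeated game: maps from histories (lists of action
  profiles, oldest first) to mixed actions.\<close>

type_synonym ('a, 'b) history = "('a \<times> 'b) list"

fun cont_value ::
  "('a::finite \<Rightarrow> 'b::finite \<Rightarrow> real) \<Rightarrow> (('a,'b) history \<Rightarrow> 'a pmf) \<Rightarrow> (('a,'b) history \<Rightarrow> 'b pmf)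
    \<Rightarrow> ('a,'b) history \<Rightarrow> nat \<Rightarrow> real" where
  "cont_value u m1 m2 h 0 = 0"
| "cont_value u m1 m2 h (Suc n) =
     (\<Sum>a1\<in>UNIV. \<Sum>a2\<in>UNIV. pmf (m1 h) a1 * pmf (m2 h) a2 *
        (u a1 a2 + cont_value u m1 m2 (h @ [(a1, a2)]) n))"

definition rep_payoff ::
  "('a::finite \<Rightarrow> 'b::finite \<Rightarrow> real) \<Rightarrow> (('a,'b) history \<Rightarrow> 'a pmf) \<Rightarrow> (('a,'b) history \<Rightarrow> 'b pmf)
    \<Rightarrow> nat \<Rightarrow> real" where
  "rep_payoff u m1 m2 T = cont_value u m1 m2 [] T"

definition rep_nash ::
  "('a::finite \<Rightarrow> 'b::finite \<Rightarrow> real) \<Rightarrow> ('a \<Rightarrow> 'b \<Rightarrow> real) \<Rightarrow> nat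
    \<Rightarrow> (('a,'b) history \<Rightarrow> 'a pmf) \<Rightarrow> (('a,'b) history \<Rightarrow> 'b pmf) \<Rightarrow> bool" where
  "rep_nash u1 u2 T m1 m2 \<longleftrightarrow>
     (\<forall>m1'. rep_payoff u1 m1' m2 T \<le> rep_payoff u1 m1 m2 T) \<and>
     (\<forall>m2'. rep_payoff u2 m1 m2' T \<le> rep_payoff u2 m1 m2 T)"

definition is_SPE ::
  "('a::finite \<Rightarrow> 'b::finite \<Rightarrow> real) \<Rightarrow> ('a \<Rightarrow> 'b \<Rightarrow> real) \<Rightarrow> nat
    \<Rightarrow> (('a,'b) history \<Rightarrow> 'a pmf) \<Rightarrow> (('a,'b) history \<Rightarrow> 'b pmf) \<Rightarrow> bool" where
  "is_SPE u1 u2 T m1 m2 \<longleftrightarrow>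
     (\<forall>h::('a,'b) history. length h < T \<longrightarrow>
        rep_nash u1 u2 (T - length h) (\<lambda>h'. m1 (h @ h')) (\<lambda>h'. m2 (h @ h')))"

definition locally_suboptimal ::
  "('a::finite \<Rightarrow> 'b::finite \<Rightarrow> real) \<Rightarrow> ('a \<Rightarrow> 'b \<Rightarrow> real) \<Rightarrow> nat
    \<Rightarrow> (('a,'b) history \<Rightarrow> 'a pmf) \<Rightarrow> (('a,'b) history \<Rightarrow> 'b pmf) \<Rightarrow> bool" where
  "locally_suboptimal u1 u2 T m1 m2 \<longleftrightarrow>
     (\<exists>h::('a,'b) history. length h < T \<and> \<not> stage_nash u1 u2 (m1 h) (m2 h))"

end

theory Submission
  imports Defs "HOL-Analysis.Analysis"
begin

text \<open>Only observed actions can be punished. By the one-shot deviation principle, an equilibrium of the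
  repeated game is a stage equilibrium of the payoffs augmented by continuation values, history by
  history. A player with a unique stage equilibrium value faces, by backward induction, constant
  continuation values as long as later play is stage Nash, so this player best-responds in the stage
  game; this gives necessity.

  For sufficiency, if both values vary, some pure profile is not Nash, and deviations from it are
  punished by long runs of bad stage equilibria. If only player 1 can be rewarded, a mixed action of
  player 1 cannot be enforced directly. Either some pure action of player 1 works, or every
  pure-action best response is Nash, so that player 2's best-response value against each pure action
  is the unique equilibrium value \<open>v\<close>. Then player 1 receives a large bonus whenever player 2 gets
  less than \<open>v\<close>: every equilibrium of the augmented game (one exists by Nash's theorem) gives
  player 2 less than \<open>v\<close> and hence is not a stage equilibrium.\<close>

section \<open>Mixed payoffs\<close>

lemma sum_pmf_finite [simp]: "(\<Sum>a\<in>UNIV. pmf (s :: 'a::finite pmf) a) = 1"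
  by (rule sum_pmf_eq_1) auto

lemma pmf_average_le:
  fixes s :: "'a::finite pmf"
  assumes "\<And>a. a \<in> set_pmf s \<Longrightarrow> f a \<le> c"
  shows "(\<Sum>a\<in>UNIV. pmf s a * f a) \<le> c"
proof -
  have "pmf s a * f a \<le> pmf s a * c" for a
    using assms[of a] by (cases "a \<in> set_pmf s") (auto simp: set_pmf_iff intro: mult_left_mono)
  then have "(\<Sum>a\<in>UNIV. pmf s a * f a) \<le> (\<Sum>a\<in>UNIV. pmf s a * c)"
    by (intro sum_mono)
  then show ?thesis
    by (simp flip: sum_distrib_right)
qed

lemma pmf_average_ge:
  fixes s :: "'a::finite pmf"
  assumes "\<And>a. a \<in> set_pmf s \<Longrightarrow> c \<le> f a"
  shows "c \<le> (\<Sum>a\<in>UNIV. pmf s a * f a)"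
  using pmf_average_le[of s "\<lambda>a. - f a" "- c"] assms by (simp add: sum_negf)

text \<open>The shortfalls \<open>c - f a\<close> are nonnegative and average to at most 0, so each
  weighted shortfall vanishes; on the support the weight is positive.\<close>

lemma pmf_average_eq_upper_bound:
  fixes s :: "'a::finite pmf"
  assumes "\<And>a. f a \<le> c" and "c \<le> (\<Sum>a\<in>UNIV. pmf s a * f a)" and "a \<in> set_pmf s"
  shows "f a = c"
proof -
  have "(\<Sum>a\<in>UNIV. pmf s a * (c - f a)) \<le> 0"
    using assms(2) by (simp add: right_diff_distrib sum_subtractf flip: sum_distrib_right)
  moreover have "pmf s a * (c - f a) \<le> (\<Sum>a\<in>UNIV. pmf s a * (c - f a))"
    by (rule member_le_sum) (auto simp: assms(1))
  ultimately have "pmf s a * (c - f a) \<le> 0"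
    by linarith
  then show ?thesis
    using assms(1)[of a] pmf_positive[OF assms(3)] by (auto simp: mult_le_0_iff)
qed

lemma mixed_payoff_return1:
  "mixed_payoff u (return_pmf a) s2 = (\<Sum>b\<in>UNIV. pmf s2 b * u a b)"
proof -
  have "mixed_payoff u (return_pmf a) s2
      = (\<Sum>a'\<in>UNIV. if a' = a then \<Sum>b\<in>UNIV. pmf s2 b * u a b else 0)"
    unfolding mixed_payoff_def by (intro sum.cong) (auto simp: indicator_def)
  then show ?thesis by simp
qed

text \<open>Exchanges the roles of the players, so that facts about player 1 carry over to player
  2.\<close>

lemma mixed_payoff_flip: "mixed_payoff (\<lambda>b a. u a b) s2 s1 = mixed_payoff u s1 s2"
proof -
  have "mixed_payoff (\<lambda>b a. u a b) s2 s1 = (\<Sum>a\<in>UNIV. \<Sum>b\<in>UNIV. pmf s2 b * pmf s1 a * u a b)"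
    unfolding mixed_payoff_def by (rule sum.swap)
  then show ?thesis
    unfolding mixed_payoff_def by (simp add: mult.commute[of "pmf s2 _"])
qed

lemma mixed_payoff_return2:
  "mixed_payoff u s1 (return_pmf b) = (\<Sum>a\<in>UNIV. pmf s1 a * u a b)"
  using mixed_payoff_return1[of "\<lambda>b a. u a b" b s1] by (simp add: mixed_payoff_flip[of u])

lemma mixed_payoff_return [simp]:
  "mixed_payoff u (return_pmf a) (return_pmf b) = u a b"
  unfolding mixed_payoff_return1 pmf_return indicator_def by (simp add: if_distribR)

lemma mixed_payoff_average1:
  "mixed_payoff u s1 s2 = (\<Sum>a\<in>UNIV. pmf s1 a * mixed_payoff u (return_pmf a) s2)"
  unfolding mixed_payoff_return1 by (simp add: mixed_payoff_def sum_distrib_left mult.assoc)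

lemma mixed_payoff_average2:
  "mixed_payoff u s1 s2 = (\<Sum>b\<in>UNIV. pmf s2 b * mixed_payoff u s1 (return_pmf b))"
  using mixed_payoff_average1[of "\<lambda>b a. u a b" s2 s1] by (simp add: mixed_payoff_flip[of u])

lemma mixed_payoff_le_pure1:
  assumes "\<And>a. mixed_payoff u (return_pmf a) s2 \<le> c"
  shows "mixed_payoff u s1 s2 \<le> c"
  unfolding mixed_payoff_average1[of u s1] by (rule pmf_average_le) (rule assms)

lemma mixed_payoff_le_pure2:
  assumes "\<And>b. mixed_payoff u s1 (return_pmf b) \<le> c"
  shows "mixed_payoff u s1 s2 \<le> c"
  by (subst mixed_payoff_average2) (rule pmf_average_le, rule assms)

lemma mixed_payoff_add:
  "mixed_payoff (\<lambda>a b. u a b + w a b) s1 s2 = mixed_payoff u s1 s2 + mixed_payoff w s1 s2"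
  by (simp add: mixed_payoff_def distrib_left sum.distrib)

lemma mixed_payoff_mult:
  "mixed_payoff (\<lambda>a b. c * u a b) s1 s2 = c * mixed_payoff u s1 s2"
  by (simp add: mixed_payoff_def sum_distrib_left mult_ac)

lemma mixed_payoff_const [simp]: "mixed_payoff (\<lambda>a b. c) s1 s2 = c"
proof -
  have "mixed_payoff (\<lambda>a b. c) s1 s2 = (\<Sum>a\<in>UNIV. pmf s1 a * c)"
    unfolding mixed_payoff_average1[of _ s1] mixed_payoff_return1 by (simp flip: sum_distrib_right)
  then show ?thesis by (simp flip: sum_distrib_right)
qed

lemma mixed_payoff_mono:
  assumes "\<And>a b. u a b \<le> w a b"
  shows "mixed_payoff u s1 s2 \<le> mixed_payoff w s1 s2"
  unfolding mixed_payoff_def by (intro sum_mono mult_left_mono assms) simp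

text \<open>The one-variable case is used twice: on the average over \<open>s1\<close> of the
  payoffs of pure actions, then on the average over \<open>s2\<close> for a fixed action in the
  support of \<open>s1\<close>.\<close>

lemma mixed_payoff_eq_upper_bound:
  assumes "\<And>a b. u a b \<le> c" and "c \<le> mixed_payoff u s1 s2"
    and "a \<in> set_pmf s1" and "b \<in> set_pmf s2"
  shows "u a b = c"
proof -
  have "mixed_payoff u (return_pmf a) s2 = c"
    using assms by (intro pmf_average_eq_upper_bound[of "\<lambda>a. mixed_payoff u (return_pmf a) s2" c s1])
      (auto intro: mixed_payoff_le_pure2 simp flip: mixed_payoff_average1)
  then show ?thesis
    using assms by (intro pmf_average_eq_upper_bound[of "u a" c s2]) (auto simp: mixed_payoff_return1)
qed

lemma payoff_bounded:
  fixes u :: "'a::finite \<Rightarrow> 'b::finite \<Rightarrow> real"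
  shows "\<exists>B. \<forall>a b. \<bar>u a b\<bar> \<le> B"
proof -
  have "\<bar>u a b\<bar> \<le> Max (range (\<lambda>(a, b). \<bar>u a b\<bar>))" for a b
    by (rule Max_ge) (auto simp: image_iff)
  then show ?thesis by blast
qed

lemma mixed_payoff_abs_le:
  assumes "\<And>a b. \<bar>u a b\<bar> \<le> B"
  shows "\<bar>mixed_payoff u s1 s2\<bar> \<le> B"
proof -
  have "u a b \<le> B" "- B \<le> u a b" for a b
    using assms[of a b] by auto
  then have "mixed_payoff u s1 s2 \<le> B" "- B \<le> mixed_payoff u s1 s2"
    using mixed_payoff_mono[of u "\<lambda>_ _. B"] mixed_payoff_mono[of "\<lambda>_ _. - B" u] by simp_all
  then show ?thesis by simp
qed

section \<open>Stage equilibria\<close>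

text \<open>Expected payoff is linear in the own strategy, so the gain from a mixed deviation is an
  average of gains from pure ones.\<close>

lemma stage_nash_iff_pure:
  "stage_nash u1 u2 s1 s2 \<longleftrightarrow>
     (\<forall>a. mixed_payoff u1 (return_pmf a) s2 \<le> mixed_payoff u1 s1 s2) \<and>
     (\<forall>b. mixed_payoff u2 s1 (return_pmf b) \<le> mixed_payoff u2 s1 s2)"
  unfolding stage_nash_def
  by (intro conj_cong iffI allI) (blast intro: mixed_payoff_le_pure1 mixed_payoff_le_pure2)+

lemma stage_nash_flip:
  "stage_nash (\<lambda>b a. u2 a b) (\<lambda>b a. u1 a b) s2 s1 \<longleftrightarrow> stage_nash u1 u2 s1 s2"
  unfolding stage_nash_def by (auto simp: mixed_payoff_flip[of u1] mixed_payoff_flip[of u2])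

text \<open>A continuation that ignores the current actions leaves the incentives of the stage game
  unchanged.\<close>

lemma stage_nash_add_const:
  "stage_nash (\<lambda>a b. u1 a b + c1) (\<lambda>a b. u2 a b + c2) s1 s2 \<longleftrightarrow> stage_nash u1 u2 s1 s2"
  unfolding stage_nash_def mixed_payoff_add by simp

section \<open>Existence of a mixed stage equilibrium by Brouwer's fixed point theorem\<close>

text \<open>Nash's gain map: at a fixed point no gain is positive, because an action played with
  positive probability and at most average payoff has zero gain.\<close>

lemma gain_map_fixed_point:
  fixes p :: "'a::finite \<Rightarrow> real" and v :: "'a \<Rightarrow> real"
  assumes p: "\<And>a. 0 \<le> p a" "(\<Sum>a\<in>UNIV. p a) = 1"
    and fixed: "\<And>a. (p a + max 0 (v a - (\<Sum>i\<in>UNIV. p i * v i))) /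
        (1 + (\<Sum>j\<in>UNIV. max 0 (v j - (\<Sum>i\<in>UNIV. p i * v i)))) = p a"
  shows "v a \<le> (\<Sum>i\<in>UNIV. p i * v i)"
proof -
  define m where "m = (\<Sum>i\<in>UNIV. p i * v i)"
  define g where "g j = max 0 (v j - m)" for j
  define S where "S = (\<Sum>j\<in>UNIV. g j)"
  have g: "0 \<le> g j" for j by (simp add: g_def)
  have S: "0 \<le> S" unfolding S_def by (intro sum_nonneg g)
  \<comment> \<open>The fixed-point equation with its denominator cleared: gains are proportional to
    probabilities, so a zero gain at a positive probability forces the total \<open>S\<close> to be
    0.\<close>
  have eq: "g j = p j * S" for j
  proof -
    have "(p j + g j) / (1 + S) = p j"
      using fixed[of j] by (simp add: g_def S_def m_def)
    then show ?thesis using S by (simp add: field_simps)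
  qed
  have "\<exists>j. 0 < p j \<and> v j \<le> m"
  proof (rule ccontr)
    assume "\<not> ?thesis"
    then have *: "p j = 0 \<or> m < v j" for j
      using p(1)[of j] by (metis less_eq_real_def not_le)
    obtain i where i: "p i \<noteq> 0"
      using p(2) by (metis sum.neutral zero_neq_one)
    have "(\<Sum>j\<in>UNIV. p j * m) < (\<Sum>j\<in>UNIV. p j * v j)"
    proof (rule sum_strict_mono_ex1)
      show "\<forall>j\<in>UNIV. p j * m \<le> p j * v j"
        using * p(1) by (metis less_eq_real_def mult_left_mono mult_zero_left)
      show "\<exists>j\<in>UNIV. p j * m < p j * v j"
        using *[of i] i p(1)[of i] by (auto intro!: exI[of _ i])
    qed simp
    then show False
      using p(2) by (simp add: m_def flip: sum_distrib_right)
  qed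
  then obtain j where "0 < p j" "v j \<le> m" by blast
  then have "S = 0"
    using eq[of j] by (simp add: g_def)
  then have "g a = 0"
    using eq by simp
  then show ?thesis
    by (simp add: g_def m_def)
qed

text \<open>Strategies are coordinate vectors here, because Brouwer's theorem needs a Euclidean
  space; \<open>v\<close> is the vector of payoffs of the pure actions.\<close>

definition gain_map :: "real ^ 'a::finite \<Rightarrow> real ^ 'a \<Rightarrow> real ^ 'a" where
  "gain_map p v = (\<chi> a. (p $ a + max 0 (v $ a - (\<Sum>i\<in>UNIV. p $ i * v $ i))) /
     (1 + (\<Sum>j\<in>UNIV. max 0 (v $ j - (\<Sum>i\<in>UNIV. p $ i * v $ i)))))"

definition prob_simplex :: "(real ^ 'a::finite) set" where
  "prob_simplex = {p. (\<forall>a. 0 \<le> p $ a) \<and> (\<Sum>a\<in>UNIV. p $ a) = 1}"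

lemma gain_denominator_pos:
  "0 < 1 + (\<Sum>j\<in>UNIV. max 0 (f (j :: 'a::finite)) :: real)"
  by (intro add_pos_nonneg sum_nonneg) auto

lemma gain_map_in_prob_simplex:
  assumes "p \<in> prob_simplex"
  shows "gain_map p v \<in> prob_simplex"
proof -
  define g where "g j = max 0 (v $ j - (\<Sum>i\<in>UNIV. p $ i * v $ i))" for j
  have pos: "0 < 1 + (\<Sum>j\<in>UNIV. g j)"
    unfolding g_def by (rule gain_denominator_pos)
  have eq: "gain_map p v $ a = (p $ a + g a) / (1 + (\<Sum>j\<in>UNIV. g j))" for a
    by (simp add: gain_map_def g_def)
  have "0 \<le> g j" for j by (simp add: g_def)
  then show ?thesis
    using assms pos by (auto simp: prob_simplex_def eq sum.distrib simp flip: sum_divide_distrib)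
qed

lemma continuous_on_gain_map:
  assumes "continuous_on S f" and "continuous_on S g"
  shows "continuous_on S (\<lambda>z. gain_map (f z) (g z))"
  unfolding gain_map_def
  by (intro continuous_intros assms) (metis gain_denominator_pos less_irrefl)

lemma convex_prob_simplex: "convex (prob_simplex :: (real ^ 'a::finite) set)"
  unfolding convex_def prob_simplex_def by (auto simp: sum.distrib simp flip: sum_distrib_left)

lemma compact_prob_simplex: "compact (prob_simplex :: (real ^ 'a::finite) set)"
proof -
  have "closed (prob_simplex :: (real ^ 'a) set)"
    unfolding prob_simplex_def
    by (intro closed_Collect_conj closed_Collect_all closed_Collect_le closed_Collect_eq continuous_intros)
  moreover have "bounded (prob_simplex :: (real ^ 'a) set)"
  proof (rule boundedI)
    fix p :: "real ^ 'a" assume "p \<in> prob_simplex"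
    then show "norm p \<le> 1"
      using norm_le_l1_cart[of p] by (simp add: prob_simplex_def)
  qed
  ultimately show ?thesis by (simp add: compact_eq_bounded_closed)
qed

lemma prob_simplex_nonempty: "prob_simplex \<noteq> ({} :: (real ^ 'a::finite) set)"
proof -
  have "(\<chi> a. pmf (return_pmf undefined) a) \<in> (prob_simplex :: (real ^ 'a) set)"
    by (simp add: prob_simplex_def del: pmf_return)
  then show ?thesis by blast
qed

lemma prob_simplex_obtain_pmf:
  fixes p :: "real ^ 'a::finite"
  assumes "p \<in> prob_simplex"
  obtains s where "\<And>a. pmf s a = p $ a"
proof
  have p: "\<And>a. 0 \<le> p $ a" "(\<Sum>a\<in>UNIV. p $ a) = 1"
    using assms by (auto simp: prob_simplex_def)
  show "pmf (embed_pmf (($) p)) a = p $ a" for a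
    by (rule pmf_embed_pmf) (auto simp: p nn_integral_count_space_finite sum_ennreal)
qed

text \<open>Brouwer's theorem applies to the pair of gain maps on the product of the two simplices;
  at a fixed point no pure action of either player beats that player's average payoff.\<close>

theorem stage_nash_exists:
  fixes u1 u2 :: "'a::finite \<Rightarrow> 'b::finite \<Rightarrow> real"
  obtains s1 s2 where "stage_nash u1 u2 s1 s2"
proof -
  define v1 :: "(real ^ 'a) \<times> (real ^ 'b) \<Rightarrow> real ^ 'a"
    where "v1 z = (\<chi> a. \<Sum>b\<in>UNIV. snd z $ b * u1 a b)" for z
  define v2 :: "(real ^ 'a) \<times> (real ^ 'b) \<Rightarrow> real ^ 'b"
    where "v2 z = (\<chi> b. \<Sum>a\<in>UNIV. fst z $ a * u2 a b)" for z
  define F where "F z = (gain_map (fst z) (v1 z), gain_map (snd z) (v2 z))" for z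
  let ?S = "(prob_simplex :: (real ^ 'a) set) \<times> (prob_simplex :: (real ^ 'b) set)"
  have "\<exists>z\<in>?S. F z = z"
  proof (rule brouwer)
    show "compact ?S" "convex ?S"
      by (auto intro!: compact_Times compact_prob_simplex convex_Times convex_prob_simplex)
    show "?S \<noteq> {}"
      by (simp add: prob_simplex_nonempty)
    show "continuous_on ?S F"
      unfolding F_def v1_def v2_def by (intro continuous_intros continuous_on_gain_map)
    show "F \<in> ?S \<rightarrow> ?S"
      by (auto simp: F_def gain_map_in_prob_simplex)
  qed blast
  then obtain p q where pq: "p \<in> prob_simplex" "q \<in> prob_simplex"
    and fp: "gain_map p (v1 (p, q)) = p" and fq: "gain_map q (v2 (p, q)) = q"
    by (auto simp: F_def)
  obtain s1 where s1: "\<And>a. pmf s1 a = p $ a" using prob_simplex_obtain_pmf[OF pq(1)] by blast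
  obtain s2 where s2: "\<And>b. pmf s2 b = q $ b" using prob_simplex_obtain_pmf[OF pq(2)] by blast
  have v1: "v1 (p, q) $ a = mixed_payoff u1 (return_pmf a) s2" for a
    by (simp add: v1_def mixed_payoff_return1 s2)
  have v2: "v2 (p, q) $ b = mixed_payoff u2 s1 (return_pmf b)" for b
    by (simp add: v2_def mixed_payoff_return2 s1)
  have "v1 (p, q) $ a \<le> (\<Sum>i\<in>UNIV. p $ i * v1 (p, q) $ i)" for a
    using pq(1) fp by (intro gain_map_fixed_point) (auto simp: prob_simplex_def gain_map_def vec_eq_iff)
  moreover have "v2 (p, q) $ b \<le> (\<Sum>i\<in>UNIV. q $ i * v2 (p, q) $ i)" for b
    using pq(2) fq by (intro gain_map_fixed_point) (auto simp: prob_simplex_def gain_map_def vec_eq_iff)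
  ultimately have "stage_nash u1 u2 s1 s2"
    unfolding stage_nash_iff_pure v1 v2 s1[symmetric] s2[symmetric]
    by (simp flip: mixed_payoff_average1 mixed_payoff_average2)
  then show ?thesis ..
qed

section \<open>The one-shot deviation principle\<close>

lemma cont_value_Suc:
  "cont_value u m1 m2 h (Suc n)
     = mixed_payoff (\<lambda>a b. u a b + cont_value u m1 m2 (h @ [(a, b)]) n) (m1 h) (m2 h)"
  by (simp add: mixed_payoff_def)

text \<open>Only play from the current history onwards matters. This identifies a continuation
  strategy started at the empty history with the original strategy at \<open>h\<close>.\<close>

lemma cont_value_cong:
  assumes "\<And>k. m1 (g @ k) = m1' (h @ k)" and "\<And>k. m2 (g @ k) = m2' (h @ k)"
  shows "cont_value u m1 m2 g n = cont_value u m1' m2' h n"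
  using assms
proof (induction n arbitrary: g h)
  case (Suc n)
  have "cont_value u m1 m2 (g @ [x]) n = cont_value u m1' m2' (h @ [x]) n" for x
    by (rule Suc.IH) (use Suc.prems in auto)
  moreover have "m1 g = m1' h" "m2 g = m2' h"
    using Suc.prems[of "[]"] by auto
  ultimately show ?case by (simp only: cont_value_Suc)
qed simp

text \<open>The one-round game faced at \<open>h\<close> when the profile is followed in the
  \<open>n\<close> rounds afterwards.\<close>

abbreviation augmented where
  "augmented u m1 m2 h n \<equiv> \<lambda>a b. u a b + cont_value u m1 m2 (h @ [(a, b)]) n"

text \<open>Induction on the remaining rounds: after the current round, following the profile is at
  least as good as deviating, and within the round \<open>m1\<close> is optimal. Here
  \<open>h\<close> is the history at which the deviation starts and \<open>g\<close> is what was
  played since.\<close>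

lemma one_shot_optimal1:
  assumes "\<And>h. length h < T \<Longrightarrow>
      \<forall>s. mixed_payoff (augmented u m1 m2 h (T - Suc (length h))) s (m2 h)
        \<le> mixed_payoff (augmented u m1 m2 h (T - Suc (length h))) (m1 h) (m2 h)"
    and "length h + length g + n = T"
  shows "cont_value u m1' (\<lambda>k. m2 (h @ k)) g n \<le> cont_value u m1 m2 (h @ g) n"
  using assms(2)
proof (induction n arbitrary: g)
  case (Suc n)
  have n: "T - Suc (length (h @ g)) = n" using Suc.prems by simp
  have "cont_value u m1' (\<lambda>k. m2 (h @ k)) g (Suc n)
      \<le> mixed_payoff (augmented u m1 m2 (h @ g) n) (m1' g) (m2 (h @ g))"
    unfolding cont_value_Suc
    by (rule mixed_payoff_mono) (use Suc.IH[of "g @ [_]"] Suc.prems in simp)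
  also have "\<dots> \<le> cont_value u m1 m2 (h @ g) (Suc n)"
    using assms(1)[of "h @ g"] Suc.prems unfolding n cont_value_Suc by simp
  finally show ?case .
qed simp

lemma one_shot_optimal2:
  assumes "\<And>h. length h < T \<Longrightarrow>
      \<forall>s. mixed_payoff (augmented u m1 m2 h (T - Suc (length h))) (m1 h) s
        \<le> mixed_payoff (augmented u m1 m2 h (T - Suc (length h))) (m1 h) (m2 h)"
    and "length h + length g + n = T"
  shows "cont_value u (\<lambda>k. m1 (h @ k)) m2' g n \<le> cont_value u m1 m2 (h @ g) n"
  using assms(2)
proof (induction n arbitrary: g)
  case (Suc n)
  have n: "T - Suc (length (h @ g)) = n" using Suc.prems by simp
  have "cont_value u (\<lambda>k. m1 (h @ k)) m2' g (Suc n)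
      \<le> mixed_payoff (augmented u m1 m2 (h @ g) n) (m1 (h @ g)) (m2' g)"
    unfolding cont_value_Suc
    by (rule mixed_payoff_mono) (use Suc.IH[of "g @ [_]"] Suc.prems in simp)
  also have "\<dots> \<le> cont_value u m1 m2 (h @ g) (Suc n)"
    using assms(1)[of "h @ g"] Suc.prems unfolding n cont_value_Suc by simp
  finally show ?case .
qed simp

text \<open>A deviation in a single round is a special deviation of the continuation game;
  conversely, the two preceding inductions rule out arbitrary deviations once single-round ones do
  not pay.\<close>

theorem is_SPE_iff_one_shot:
  "is_SPE u1 u2 T m1 m2 \<longleftrightarrow>
     (\<forall>h. length h < T \<longrightarrow>
        stage_nash (augmented u1 m1 m2 h (T - Suc (length h)))
          (augmented u2 m1 m2 h (T - Suc (length h))) (m1 h) (m2 h))"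
  (is "_ \<longleftrightarrow> ?R")
proof
  assume spe: "is_SPE u1 u2 T m1 m2"
  show ?R
  proof (intro allI impI)
    fix h :: "('a, 'b) history" assume h: "length h < T"
    define n where "n = T - Suc (length h)"
    let ?m1 = "\<lambda>k. m1 (h @ k)" and ?m2 = "\<lambda>k. m2 (h @ k)"
    have "rep_nash u1 u2 (Suc n) ?m1 ?m2"
      using spe h unfolding is_SPE_def n_def by (metis Suc_diff_Suc)
    then have dev1: "cont_value u1 m1' ?m2 [] (Suc n) \<le> cont_value u1 ?m1 ?m2 [] (Suc n)"
      and dev2: "cont_value u2 ?m1 m2' [] (Suc n) \<le> cont_value u2 ?m1 ?m2 [] (Suc n)" for m1' m2'
      unfolding rep_nash_def rep_payoff_def by blast+
    have eq: "cont_value u ?m1 ?m2 [] (Suc n)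
        = mixed_payoff (augmented u m1 m2 h n) (m1 h) (m2 h)" for u
      by (subst cont_value_cong[of ?m1 "[]" m1 h ?m2 m2]) (simp_all add: cont_value_Suc del: cont_value.simps)
    show "stage_nash (augmented u1 m1 m2 h (T - Suc (length h)))
        (augmented u2 m1 m2 h (T - Suc (length h))) (m1 h) (m2 h)"
      unfolding stage_nash_def n_def[symmetric]
    proof (intro conjI allI)
      fix s
      \<comment> \<open>Deviates in the first round of the continuation only; all later histories
        are nonempty, so play returns to the profile.\<close>
      let ?d = "\<lambda>k. if k = [] then s else ?m1 k"
      have "cont_value u1 ?d ?m2 [(a, b)] n = cont_value u1 m1 m2 (h @ [(a, b)]) n" for a b
        by (rule cont_value_cong) auto
      then have "cont_value u1 ?d ?m2 [] (Suc n) = mixed_payoff (augmented u1 m1 m2 h n) s (m2 h)"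
        by (simp add: cont_value_Suc del: cont_value.simps)
      then show "mixed_payoff (augmented u1 m1 m2 h n) s (m2 h)
          \<le> mixed_payoff (augmented u1 m1 m2 h n) (m1 h) (m2 h)"
        using dev1[of ?d] unfolding eq by linarith
    next
      fix s
      let ?d = "\<lambda>k. if k = [] then s else ?m2 k"
      have "cont_value u2 ?m1 ?d [(a, b)] n = cont_value u2 m1 m2 (h @ [(a, b)]) n" for a b
        by (rule cont_value_cong) auto
      then have "cont_value u2 ?m1 ?d [] (Suc n) = mixed_payoff (augmented u2 m1 m2 h n) (m1 h) s"
        by (simp add: cont_value_Suc del: cont_value.simps)
      then show "mixed_payoff (augmented u2 m1 m2 h n) (m1 h) s
          \<le> mixed_payoff (augmented u2 m1 m2 h n) (m1 h) (m2 h)"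
        using dev2[of ?d] unfolding eq by linarith
    qed
  qed
next
  assume R: ?R
  show "is_SPE u1 u2 T m1 m2"
    unfolding is_SPE_def rep_nash_def rep_payoff_def
  proof (intro allI impI conjI)
    fix h :: "('a, 'b) history" and m1' assume h: "length h < T"
    have "cont_value u1 m1' (\<lambda>k. m2 (h @ k)) [] (T - length h) \<le> cont_value u1 m1 m2 (h @ []) (T - length h)"
      using R h by (intro one_shot_optimal1[where T = T]) (auto simp: stage_nash_def)
    also have "\<dots> = cont_value u1 (\<lambda>k. m1 (h @ k)) (\<lambda>k. m2 (h @ k)) [] (T - length h)"
      by (rule cont_value_cong) auto
    finally show "cont_value u1 m1' (\<lambda>k. m2 (h @ k)) [] (T - length h)
        \<le> cont_value u1 (\<lambda>k. m1 (h @ k)) (\<lambda>k. m2 (h @ k)) [] (T - length h)" .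
  next
    fix h :: "('a, 'b) history" and m2' assume h: "length h < T"
    have "cont_value u2 (\<lambda>k. m1 (h @ k)) m2' [] (T - length h) \<le> cont_value u2 m1 m2 (h @ []) (T - length h)"
      using R h by (intro one_shot_optimal2[where T = T]) (auto simp: stage_nash_def)
    also have "\<dots> = cont_value u2 (\<lambda>k. m1 (h @ k)) (\<lambda>k. m2 (h @ k)) [] (T - length h)"
      by (rule cont_value_cong) auto
    finally show "cont_value u2 (\<lambda>k. m1 (h @ k)) m2' [] (T - length h)
        \<le> cont_value u2 (\<lambda>k. m1 (h @ k)) (\<lambda>k. m2 (h @ k)) [] (T - length h)" .
  qed
qed

section \<open>Necessity\<close>

text \<open>Each remaining round is a stage equilibrium and contributes exactly \<open>v\<close>,
  whatever happened before, so the future gives this player no incentive today.\<close>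

lemma cont_value_stage_nash_unique_value:
  assumes v: "nash_values u1 u2 u = {v}"
    and nash: "\<And>g. length g < T \<Longrightarrow> length h \<le> length g \<Longrightarrow> stage_nash u1 u2 (m1 g) (m2 g)"
    and "length h + n = T"
  shows "cont_value u m1 m2 h n = n * v"
  using assms(2,3)
proof (induction n arbitrary: h)
  case (Suc n)
  have "cont_value u m1 m2 (h @ [x]) n = n * v" for x
    using Suc.prems by (intro Suc.IH) auto
  moreover have "mixed_payoff u (m1 h) (m2 h) \<in> nash_values u1 u2 u"
    using Suc.prems(1)[of h] Suc.prems(2) by (auto simp: nash_values_def)
  ultimately show ?case
    unfolding cont_value_Suc by (simp add: mixed_payoff_add v algebra_simps)
qed simp

text \<open>Strong induction on the remaining rounds: if all later play is stage Nash, a player with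
  a unique value has a constant continuation and so best-responds in the stage game at
  \<open>h\<close>. The hypothesis \<open>stage\<close> turns this into stage Nash play and covers
  all combinations of unique and varying values in one induction.\<close>

lemma SPE_all_stage_nash:
  fixes u1 u2 :: "'a::finite \<Rightarrow> 'b::finite \<Rightarrow> real"
  assumes spe: "is_SPE u1 u2 T m1 m2"
    and stage: "\<And>s1 s2.
      ((\<exists>v. nash_values u1 u2 u1 = {v}) \<longrightarrow> (\<forall>s. mixed_payoff u1 s s2 \<le> mixed_payoff u1 s1 s2)) \<Longrightarrow>
      ((\<exists>v. nash_values u1 u2 u2 = {v}) \<longrightarrow> (\<forall>s. mixed_payoff u2 s1 s \<le> mixed_payoff u2 s1 s2)) \<Longrightarrow>
      stage_nash u1 u2 s1 s2"
  shows "length h < T \<Longrightarrow> stage_nash u1 u2 (m1 h) (m2 h)"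
proof (induction "T - length h" arbitrary: h rule: less_induct)
  case less
  let ?n = "T - Suc (length h)"
  have later: "length g < T \<Longrightarrow> length (h @ [x]) \<le> length g \<Longrightarrow> stage_nash u1 u2 (m1 g) (m2 g)" for g x
    using less.prems by (intro less.hyps) auto
  have const: "cont_value u m1 m2 (h @ [x]) ?n = real ?n * v" if "nash_values u1 u2 u = {v}" for u v x
  proof (rule cont_value_stage_nash_unique_value[OF that])
    show "length g < T \<Longrightarrow> length (h @ [x]) \<le> length g \<Longrightarrow> stage_nash u1 u2 (m1 g) (m2 g)" for g
      by (rule later)
    show "length (h @ [x]) + ?n = T"
      using less.prems by simp
  qed
  have "stage_nash (augmented u1 m1 m2 h ?n) (augmented u2 m1 m2 h ?n) (m1 h) (m2 h)"
    using spe less.prems unfolding is_SPE_iff_one_shot by blast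
  then show ?case
    by (intro stage) (auto simp: stage_nash_def mixed_payoff_add const)
qed

text \<open>Since an equilibrium exists, the set of values is never empty.\<close>

lemma nash_values_singleton_cases:
  obtains v where "nash_values u1 u2 u = {v}"
  | x y where "x \<in> nash_values u1 u2 u" "y \<in> nash_values u1 u2 u" "x < y"
proof -
  obtain s1 s2 where "stage_nash u1 u2 s1 s2" by (rule stage_nash_exists)
  then have "mixed_payoff u s1 s2 \<in> nash_values u1 u2 u" by (auto simp: nash_values_def)
  then show ?thesis
    using that by (metis is_singletonI' is_singletonE empty_iff linorder_neqE_linordered_idom)
qed

section \<open>Sufficiency\<close>

text \<open>Play follows the script \<open>xs\<close> regardless of observed actions;
  \<open>i\<close> is the position of the current round, so \<open>drop i xs\<close> holds exactly
  the \<open>n\<close> rounds still to be played.\<close>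

lemma cont_value_history_independent:
  assumes "\<And>k. length k < n \<Longrightarrow> m1 (h @ k) = fst (xs ! (i + length k)) \<and> m2 (h @ k) = snd (xs ! (i + length k))"
    and "i + n = length xs"
  shows "cont_value u m1 m2 h n = (\<Sum>(s1, s2)\<leftarrow>drop i xs. mixed_payoff u s1 s2)"
  using assms
proof (induction n arbitrary: h i)
  case (Suc n)
  have "cont_value u m1 m2 (h @ [x]) n = (\<Sum>(s1, s2)\<leftarrow>drop (Suc i) xs. mixed_payoff u s1 s2)" for x
    using Suc.prems(1)[of "x # _"] Suc.prems(2) by (intro Suc.IH) auto
  moreover have "m1 h = fst (xs ! i)" "m2 h = snd (xs ! i)"
    using Suc.prems(1)[of "[]"] by auto
  moreover have "drop i xs = xs ! i # drop (Suc i) xs"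
    using Suc.prems(2) by (simp add: Cons_nth_drop_Suc)
  ultimately show ?case
    unfolding cont_value_Suc by (simp add: mixed_payoff_add case_prod_unfold)
qed simp

text \<open>Here \<open>xs a b\<close> lists the stage equilibria played after the first-round actions \<open>(a, b)\<close>.\<close>

lemma SPE_from_continuation_lists:
  fixes u1 u2 :: "'a::finite \<Rightarrow> 'b::finite \<Rightarrow> real"
  assumes len: "\<And>a b. length (xs a b) = N"
    and nash: "\<And>a b s1 s2. (s1, s2) \<in> set (xs a b) \<Longrightarrow> stage_nash u1 u2 s1 s2"
    and first: "stage_nash
        (\<lambda>a b. u1 a b + (\<Sum>(s1, s2)\<leftarrow>xs a b. mixed_payoff u1 s1 s2))
        (\<lambda>a b. u2 a b + (\<Sum>(s1, s2)\<leftarrow>xs a b. mixed_payoff u2 s1 s2)) \<sigma>1 \<sigma>2"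
    and subopt: "\<not> stage_nash u1 u2 \<sigma>1 \<sigma>2"
  shows "\<exists>T m1 m2. T \<ge> 1 \<and> is_SPE u1 u2 T m1 m2 \<and> locally_suboptimal u1 u2 T m1 m2"
proof -
  \<comment> \<open>The first-round actions select a list; later actions are ignored. After
    \<open>x # k\<close> exactly \<open>length k\<close> entries have been used, which is the index
    of the next one.\<close>
  define play where "play h = (case h of [] \<Rightarrow> (\<sigma>1, \<sigma>2) | x # k \<Rightarrow> xs (fst x) (snd x) ! length k)"
    for h :: "('a, 'b) history"
  define m1 where "m1 h = fst (play h)" for h
  define m2 where "m2 h = snd (play h)" for h
  have cont: "cont_value u m1 m2 ((a, b) # k) n
      = (\<Sum>(s1, s2)\<leftarrow>drop (length k) (xs a b). mixed_payoff u s1 s2)"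
    if "length k + n = N" for u a b k n
    using that by (intro cont_value_history_independent) (auto simp: m1_def m2_def play_def len)
  have "is_SPE u1 u2 (Suc N) m1 m2"
    unfolding is_SPE_iff_one_shot
  proof (intro allI impI)
    fix h :: "('a, 'b) history" assume h: "length h < Suc N"
    show "stage_nash (augmented u1 m1 m2 h (Suc N - Suc (length h)))
        (augmented u2 m1 m2 h (Suc N - Suc (length h))) (m1 h) (m2 h)"
    proof (cases h)
      case Nil
      then show ?thesis
        using first by (simp add: cont m1_def m2_def play_def)
    next
      case (Cons x k)
      obtain a b where x: "x = (a, b)" by (cases x)
      have k: "length k < N" using h Cons by simp
      \<comment> \<open>After the first round the continuation value depends only on
        \<open>a\<close>, \<open>b\<close> and \<open>length k\<close>, so the augmented payoffs
        differ from the stage payoffs by a constant.\<close>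
      have "augmented u m1 m2 h (Suc N - Suc (length h)) = (\<lambda>a' b'. u a' b' +
          (\<Sum>(s1, s2)\<leftarrow>drop (Suc (length k)) (xs a b). mixed_payoff u s1 s2))" for u
        using k by (simp add: Cons x cont)
      moreover have "(m1 h, m2 h) \<in> set (xs a b)"
        using k by (simp add: m1_def m2_def play_def Cons x len)
      ultimately show ?thesis
        using nash by (simp add: stage_nash_add_const)
    qed
  qed
  moreover have "locally_suboptimal u1 u2 (Suc N) m1 m2"
    unfolding locally_suboptimal_def
    using subopt by (intro exI[of _ "[]"]) (simp add: m1_def m2_def play_def)
  ultimately show ?thesis
    by (intro exI[of _ "Suc N"]) auto
qed

lemma ex_large_multiple:
  fixes c d :: real
  assumes "0 < d"
  obtains M :: nat where "c \<le> real M * d"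
  using ex_less_of_nat_mult[OF assms, of c] by (metis less_imp_le)

section \<open>Both players' equilibrium values vary\<close>

text \<open>If all pure profiles were Nash, no player could influence the own payoff, and every
  mixed profile would be Nash. A pure profile is wanted because every deviation from it is
  observed.\<close>

lemma not_stage_nash_obtain_pure:
  assumes "\<not> stage_nash u1 u2 s1 s2"
  obtains a b where "\<not> stage_nash u1 u2 (return_pmf a) (return_pmf b)"
proof (rule ccontr)
  assume "\<not> thesis"
  then have all: "stage_nash u1 u2 (return_pmf a) (return_pmf b)" for a b
    using that by blast
  have "u1 a b = u1 a' b" for a a' b
    using all[of a b] all[of a' b] unfolding stage_nash_iff_pure by (metis antisym mixed_payoff_return)
  then have 1: "mixed_payoff u1 (return_pmf a) s2 = mixed_payoff u1 (return_pmf a') s2" for a a'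
    unfolding mixed_payoff_return1 by metis
  have "u2 a b = u2 a b'" for a b b'
    using all[of a b] all[of a b'] unfolding stage_nash_iff_pure by (metis antisym mixed_payoff_return)
  then have 2: "mixed_payoff u2 s1 (return_pmf b) = mixed_payoff u2 s1 (return_pmf b')" for b b'
    unfolding mixed_payoff_return2 by metis
  have "mixed_payoff u1 (return_pmf a) s2 \<le> mixed_payoff u1 s1 s2" for a
    unfolding mixed_payoff_average1[of u1 s1] by (rule pmf_average_ge) (metis 1 order_refl)
  moreover have "mixed_payoff u2 s1 (return_pmf b) \<le> mixed_payoff u2 s1 s2" for b
    unfolding mixed_payoff_average2[of u2 s1 s2] by (rule pmf_average_ge) (metis 2 order_refl)
  ultimately have "stage_nash u1 u2 s1 s2"
    unfolding stage_nash_iff_pure by blast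
  with assms show False by simp
qed

lemma SPE_both_values_vary:
  fixes u1 u2 :: "'a::finite \<Rightarrow> 'b::finite \<Rightarrow> real"
  assumes x: "x \<in> nash_values u1 u2 u1" "x' \<in> nash_values u1 u2 u1" "x' < x"
    and y: "y \<in> nash_values u1 u2 u2" "y' \<in> nash_values u1 u2 u2" "y' < y"
    and "\<not> stage_nash u1 u2 s1 s2"
  shows "\<exists>T m1 m2. T \<ge> 1 \<and> is_SPE u1 u2 T m1 m2 \<and> locally_suboptimal u1 u2 T m1 m2"
proof -
  obtain a b where ab: "\<not> stage_nash u1 u2 (return_pmf a) (return_pmf b)"
    using not_stage_nash_obtain_pure[OF assms(7)] by blast
  obtain p1 p2 where p: "stage_nash u1 u2 p1 p2" "x = mixed_payoff u1 p1 p2"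
    using x unfolding nash_values_def by auto
  obtain p1' p2' where p': "stage_nash u1 u2 p1' p2'" "x' = mixed_payoff u1 p1' p2'"
    using x unfolding nash_values_def by auto
  obtain q1 q2 where q: "stage_nash u1 u2 q1 q2" "y = mixed_payoff u2 q1 q2"
    using y unfolding nash_values_def by auto
  obtain q1' q2' where q': "stage_nash u1 u2 q1' q2'" "y' = mixed_payoff u2 q1' q2'"
    using y unfolding nash_values_def by auto
  obtain B1 where B1: "\<And>a b. \<bar>u1 a b\<bar> \<le> B1" using payoff_bounded[of u1] by blast
  obtain B2 where B2: "\<And>a b. \<bar>u2 a b\<bar> \<le> B2" using payoff_bounded[of u2] by blast
  \<comment> \<open>Two stage payoffs differ by at most \<open>2 * B1\<close>, so \<open>M1\<close>
    rounds of the better equilibrium outweigh any gain in the first round.\<close>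
  obtain M1 where M1: "2 * B1 \<le> real M1 * (x - x')"
    using ex_large_multiple[of "x - x'"] x by auto
  obtain M2 where M2: "2 * B2 \<le> real M2 * (y - y')"
    using ex_large_multiple[of "y - y'"] y by auto
  \<comment> \<open>The first block depends only on player 1's action and the second only on player
    2's, so a deviation changes only the block meant for the deviator.\<close>
  define xs where "xs i j = replicate M1 (if i = a then (p1, p2) else (p1', p2')) @
      replicate M2 (if j = b then (q1, q2) else (q1', q2'))" for i j
  show ?thesis
  proof (rule SPE_from_continuation_lists[OF _ _ _ ab])
    show "length (xs i j) = M1 + M2" for i j
      by (simp add: xs_def)
    show "stage_nash u1 u2 s1 s2" if "(s1, s2) \<in> set (xs i j)" for i j s1 s2
      using that p p' q q' by (auto simp: xs_def split: if_splits)
    have "u1 i b \<le> u1 a b + real M1 * (x - x')" for i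
      using B1[of i b] B1[of a b] M1 by linarith
    moreover have "u2 a j \<le> u2 a b + real M2 * (y - y')" for j
      using B2[of a j] B2[of a b] M2 by linarith
    ultimately show "stage_nash
        (\<lambda>i j. u1 i j + (\<Sum>(s1, s2)\<leftarrow>xs i j. mixed_payoff u1 s1 s2))
        (\<lambda>i j. u2 i j + (\<Sum>(s1, s2)\<leftarrow>xs i j. mixed_payoff u2 s1 s2))
        (return_pmf a) (return_pmf b)"
      unfolding stage_nash_iff_pure mixed_payoff_return
      by (auto simp: xs_def sum_list_replicate p(2)[symmetric] p'(2)[symmetric]
          q(2)[symmetric] q'(2)[symmetric] algebra_simps)
  qed
qed

section \<open>Bonuses for player 1 when player 2's equilibrium value is unique\<close>

text \<open>Leaving \<open>a\<close> forfeits \<open>D\<close>, which is at least the largest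
  possible stage gain \<open>2 * B\<close>; player 2's payoffs are unchanged, so \<open>br\<close>
  suffices.\<close>

lemma stage_nash_bonus_observable:
  assumes br: "\<And>s. mixed_payoff u2 (return_pmf a) s \<le> mixed_payoff u2 (return_pmf a) s2"
    and B: "\<And>a b. \<bar>u1 a b\<bar> \<le> B" and D: "2 * B \<le> D"
  shows "stage_nash (\<lambda>i j. u1 i j + D * of_bool (i = a)) u2 (return_pmf a) s2"
proof -
  have "mixed_payoff (\<lambda>i j. of_bool (i = a)) (return_pmf i) s2 = of_bool (i = a)" for i
    by (simp add: mixed_payoff_return1 flip: sum_distrib_right)
  then have "mixed_payoff (\<lambda>i j. u1 i j + D * of_bool (i = a)) (return_pmf i) s2
      = mixed_payoff u1 (return_pmf i) s2 + D * of_bool (i = a)" for i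
    unfolding mixed_payoff_add by (simp only: mixed_payoff_mult)
  moreover have "mixed_payoff u1 (return_pmf i) s2 \<le> mixed_payoff u1 (return_pmf a) s2 + D" for i
    using mixed_payoff_abs_le[of u1 B "return_pmf i" s2, OF B]
      mixed_payoff_abs_le[of u1 B "return_pmf a" s2, OF B] D by linarith
  ultimately show ?thesis
    unfolding stage_nash_iff_pure using br by (auto simp: of_bool_def simp del: mixed_payoff_return)
qed

text \<open>Otherwise the bonus would have probability zero in equilibrium, although some action of player 1
  earns it with probability at least \<open>1 / CARD('a)\<close>.\<close>

lemma bonus_equilibrium_less:
  fixes u1 u2 :: "'a::finite \<Rightarrow> 'b::finite \<Rightarrow> real"
  assumes le: "\<And>a b. u2 a b \<le> v" and less: "\<And>b. \<exists>a. u2 a b < v"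
    and B: "\<And>a b. \<bar>u1 a b\<bar> \<le> B" and D: "2 * B * CARD('a) < D"
    and nash: "stage_nash (\<lambda>a b. u1 a b + D * of_bool (u2 a b < v)) u2 s1 s2"
  shows "mixed_payoff u2 s1 s2 < v"
proof (rule ccontr)
  let ?G = "\<lambda>a b. of_bool (u2 a b < v) :: real"
  assume "\<not> ?thesis"
  then have v: "u2 a b = v" if "a \<in> set_pmf s1" "b \<in> set_pmf s2" for a b
    using mixed_payoff_eq_upper_bound[of u2 v s1 s2 a b, OF le _ that] by simp
  have "0 \<le> B" using B[of undefined undefined] by linarith
  then have "0 \<le> D" using D by (smt (verit) mult_nonneg_nonneg of_nat_0_le_iff)
  \<comment> \<open>On the support player 2 gets exactly \<open>v\<close>, so the bonus is never
    paid.\<close>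
  have "pmf s1 a * pmf s2 b * ?G a b = 0" for a b
    using v[of a b] by (auto simp: set_pmf_iff)
  then have "mixed_payoff ?G s1 s2 = 0"
    by (simp only: mixed_payoff_def sum.neutral_const)
  then have eq: "mixed_payoff (\<lambda>a b. u1 a b + D * ?G a b) s1 s2 \<le> B"
    using mixed_payoff_abs_le[of u1 B s1 s2, OF B] unfolding mixed_payoff_add mixed_payoff_mult by simp
  \<comment> \<open>The equilibrium pays player 1 at most \<open>B\<close>, while deviating to
    \<open>a\<close> pays at least \<open>- B\<close> plus the expected bonus.\<close>
  have "D * mixed_payoff ?G (return_pmf a) s2 \<le> 2 * B" for a
  proof -
    have "mixed_payoff u1 (return_pmf a) s2 + D * mixed_payoff ?G (return_pmf a) s2 \<le> B"
      using nash eq unfolding stage_nash_def mixed_payoff_add mixed_payoff_mult by (meson order_trans)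
    then show ?thesis
      using mixed_payoff_abs_le[of u1 B "return_pmf a" s2, OF B] by linarith
  qed
  then have "(\<Sum>a\<in>UNIV. D * mixed_payoff ?G (return_pmf a) s2) \<le> (\<Sum>a\<in>(UNIV::'a set). 2 * B)"
    by (intro sum_mono)
  then have "D * (\<Sum>a\<in>UNIV. mixed_payoff ?G (return_pmf a) s2) \<le> 2 * B * CARD('a)"
    by (simp add: sum_distrib_left mult.commute)
  moreover have "1 \<le> (\<Sum>a\<in>UNIV. mixed_payoff ?G (return_pmf a) s2)"
  proof -
    \<comment> \<open>Against every \<open>b\<close> some action earns the bonus; after swapping the
      sums, the bonus probabilities of player 1's actions add up to at least 1.\<close>
    have "1 \<le> (\<Sum>b\<in>UNIV. pmf s2 b * (\<Sum>a\<in>UNIV. ?G a b))"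
    proof (rule pmf_average_ge)
      fix b
      obtain a where "u2 a b < v" using less by blast
      then show "1 \<le> (\<Sum>a\<in>UNIV. ?G a b)"
        using member_le_sum[of a UNIV "\<lambda>a. ?G a b"] by simp
    qed
    also have "\<dots> = (\<Sum>a\<in>UNIV. mixed_payoff ?G (return_pmf a) s2)"
      unfolding mixed_payoff_return1 sum_distrib_left by (rule sum.swap)
    finally show ?thesis .
  qed
  then have "D * 1 \<le> D * (\<Sum>a\<in>UNIV. mixed_payoff ?G (return_pmf a) s2)"
    using \<open>0 \<le> D\<close> by (intro mult_left_mono)
  ultimately show False
    using D by linarith
qed

text \<open>Continuation play delivers bonuses in integer multiples of a gap between equilibrium
  values, so the conclusion is stated for all large \<open>D\<close>. The case split asks whether
  player 1 has a profitable deviation from some pure action met by a best reply.\<close>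

lemma suboptimal_bonus_equilibrium:
  fixes u1 u2 :: "'a::finite \<Rightarrow> 'b::finite \<Rightarrow> real"
  assumes val: "nash_values u1 u2 u2 = {v}"
    and dev: "mixed_payoff u1 s1 s2 < mixed_payoff u1 (return_pmf a') s2"
    and br: "\<And>s. mixed_payoff u2 s1 s \<le> mixed_payoff u2 s1 s2"
  obtains D0 where "\<And>D. D0 \<le> D \<Longrightarrow> \<exists>G \<sigma>1 \<sigma>2.
      stage_nash (\<lambda>a b. u1 a b + D * of_bool (G a b)) u2 \<sigma>1 \<sigma>2 \<and> \<not> stage_nash u1 u2 \<sigma>1 \<sigma>2"
proof -
  obtain B where B: "\<And>a b. \<bar>u1 a b\<bar> \<le> B" using payoff_bounded[of u1] by blast
  show ?thesis
  proof (cases "\<exists>a t s. (\<forall>s. mixed_payoff u2 (return_pmf a) s \<le> mixed_payoff u2 (return_pmf a) t) \<and>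
      mixed_payoff u1 (return_pmf a) t < mixed_payoff u1 s t")
    case True
    then obtain a t s where t: "\<And>s. mixed_payoff u2 (return_pmf a) s \<le> mixed_payoff u2 (return_pmf a) t"
      and s: "mixed_payoff u1 (return_pmf a) t < mixed_payoff u1 s t" by blast
    have subopt: "\<not> stage_nash u1 u2 (return_pmf a) t"
      using s unfolding stage_nash_def by (meson not_le)
    show ?thesis
    proof (rule that[of "2 * B"])
      fix D assume "2 * B \<le> D"
      with t B have "stage_nash (\<lambda>i j. u1 i j + D * of_bool (i = a)) u2 (return_pmf a) t"
        by (rule stage_nash_bonus_observable)
      with subopt show "\<exists>G \<sigma>1 \<sigma>2. stage_nash (\<lambda>a b. u1 a b + D * of_bool (G a b)) u2 \<sigma>1 \<sigma>2 \<and>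
          \<not> stage_nash u1 u2 \<sigma>1 \<sigma>2"
        by (intro exI[of _ "\<lambda>i j. i = a"]) blast
    qed
  next
    case False
    then have pure: "mixed_payoff u1 s t \<le> mixed_payoff u1 (return_pmf a) t"
      if "\<And>s. mixed_payoff u2 (return_pmf a) s \<le> mixed_payoff u2 (return_pmf a) t" for a t s
      using that by (meson not_le)
    have nash_value: "mixed_payoff u2 t1 t2 = v" if "stage_nash u1 u2 t1 t2" for t1 t2
      using val that by (auto simp: nash_values_def)
    \<comment> \<open>By \<open>pure\<close>, the action \<open>a\<close> and a best pure reply
      \<open>c\<close> form an equilibrium, so the maximum of \<open>u2 a\<close> is the unique
      value \<open>v\<close>.\<close>
    have le: "u2 a b \<le> v" for a b
    proof -
      have "Max (range (u2 a)) \<in> range (u2 a)" by (intro Max_in) auto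
      then obtain c where c: "u2 a c = Max (range (u2 a))" by (metis imageE)
      have "mixed_payoff u2 (return_pmf a) s \<le> mixed_payoff u2 (return_pmf a) (return_pmf c)" for s
        by (rule mixed_payoff_le_pure2) (simp add: c)
      with pure have "stage_nash u1 u2 (return_pmf a) (return_pmf c)"
        unfolding stage_nash_def by blast
      from nash_value[OF this] have "u2 a c = v" by simp
      then show ?thesis using c by (metis Max_ge finite finite_imageI rangeI)
    qed
    \<comment> \<open>Otherwise \<open>s2\<close> gives \<open>v\<close> against every pure action
      in the support of \<open>s1\<close> and is a best reply to each. By \<open>pure\<close>, none
      of these does worse than \<open>a'\<close> against \<open>s2\<close>, so neither does
      \<open>s1\<close>, contradicting \<open>dev\<close>.\<close>
    have "mixed_payoff u2 s1 s2 < v"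
    proof (rule ccontr)
      assume "\<not> ?thesis"
      then have eq: "u2 a b = v" if "a \<in> set_pmf s1" "b \<in> set_pmf s2" for a b
        using mixed_payoff_eq_upper_bound[of u2 v s1 s2 a b, OF le _ that] by simp
      have "mixed_payoff u1 (return_pmf a') s2 \<le> mixed_payoff u1 (return_pmf a) s2"
        if a: "a \<in> set_pmf s1" for a
      proof (rule pure)
        fix s
        have "mixed_payoff u2 (return_pmf a) s \<le> v"
          using mixed_payoff_mono[of u2 "\<lambda>_ _. v"] le by simp
        also have "v \<le> mixed_payoff u2 (return_pmf a) s2"
          unfolding mixed_payoff_return1 by (rule pmf_average_ge) (simp add: eq a)
        finally show "mixed_payoff u2 (return_pmf a) s \<le> mixed_payoff u2 (return_pmf a) s2" .
      qed
      then have "mixed_payoff u1 (return_pmf a') s2 \<le> mixed_payoff u1 s1 s2"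
        unfolding mixed_payoff_average1[of u1 s1] by (rule pmf_average_ge)
      with dev show False by simp
    qed
    \<comment> \<open>Otherwise \<open>b\<close> would secure \<open>v\<close> against
      \<open>s1\<close>, more than the best reply \<open>s2\<close> yields.\<close>
    have less: "\<exists>a. u2 a b < v" for b
    proof (rule ccontr)
      assume "\<nexists>a. u2 a b < v"
      then have "v \<le> mixed_payoff u2 s1 (return_pmf b)"
        unfolding mixed_payoff_return2 by (intro pmf_average_ge) (simp add: not_less)
      with br[of "return_pmf b"] \<open>mixed_payoff u2 s1 s2 < v\<close> show False by linarith
    qed
    show ?thesis
    proof (rule that[of "2 * B * CARD('a) + 1"])
      fix D assume D: "2 * B * CARD('a) + 1 \<le> D"
      obtain \<sigma>1 \<sigma>2 where nash: "stage_nash (\<lambda>a b. u1 a b + D * of_bool (u2 a b < v)) u2 \<sigma>1 \<sigma>2"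
        by (rule stage_nash_exists)
      have "mixed_payoff u2 \<sigma>1 \<sigma>2 < v"
        using D by (intro bonus_equilibrium_less[OF le less B _ nash]) simp
      then have "\<not> stage_nash u1 u2 \<sigma>1 \<sigma>2"
        using nash_value by auto
      with nash show "\<exists>G \<sigma>1 \<sigma>2. stage_nash (\<lambda>a b. u1 a b + D * of_bool (G a b)) u2 \<sigma>1 \<sigma>2 \<and>
          \<not> stage_nash u1 u2 \<sigma>1 \<sigma>2" by (intro exI[of _ "\<lambda>a b. u2 a b < v"]) blast
    qed
  qed
qed

section \<open>Delivering the bonus through continuation play, for either player\<close>

lemma nash_values_flip:
  "nash_values (\<lambda>b a. u2 a b) (\<lambda>b a. u1 a b) (\<lambda>b a. u a b) = nash_values u1 u2 u"
  unfolding nash_values_def by (auto simp: stage_nash_flip[of u2 u1] mixed_payoff_flip[of u])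

lemma SPE_value1_varies:
  fixes u1 u2 :: "'a::finite \<Rightarrow> 'b::finite \<Rightarrow> real"
  assumes x: "x \<in> nash_values u1 u2 u1" "x' \<in> nash_values u1 u2 u1" "x' < x"
    and val: "nash_values u1 u2 u2 = {v}"
    and dev: "mixed_payoff u1 s1 s2 < mixed_payoff u1 (return_pmf a') s2"
    and br: "\<And>s. mixed_payoff u2 s1 s \<le> mixed_payoff u2 s1 s2"
  shows "\<exists>T m1 m2. T \<ge> 1 \<and> is_SPE u1 u2 T m1 m2 \<and> locally_suboptimal u1 u2 T m1 m2"
proof -
  obtain D0 where D0: "\<And>D. D0 \<le> D \<Longrightarrow> \<exists>G \<sigma>1 \<sigma>2.
      stage_nash (\<lambda>a b. u1 a b + D * of_bool (G a b)) u2 \<sigma>1 \<sigma>2 \<and> \<not> stage_nash u1 u2 \<sigma>1 \<sigma>2"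
    using suboptimal_bonus_equilibrium[OF val dev br] by blast
  obtain M where "D0 \<le> real M * (x - x')"
    using ex_large_multiple[of "x - x'"] x by auto
  with D0 obtain G \<sigma>1 \<sigma>2 where
    nash: "stage_nash (\<lambda>a b. u1 a b + real M * (x - x') * of_bool (G a b)) u2 \<sigma>1 \<sigma>2"
    and subopt: "\<not> stage_nash u1 u2 \<sigma>1 \<sigma>2" by blast
  obtain p1 p2 where p: "stage_nash u1 u2 p1 p2" "mixed_payoff u1 p1 p2 = x"
    using x unfolding nash_values_def by auto
  obtain p1' p2' where p': "stage_nash u1 u2 p1' p2'" "mixed_payoff u1 p1' p2' = x'"
    using x unfolding nash_values_def by auto
  have v: "mixed_payoff u2 p1 p2 = v" "mixed_payoff u2 p1' p2' = v"
    using val p(1) p'(1) by (auto simp: nash_values_def)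
  \<comment> \<open>Player 1 gets \<open>x\<close> instead of \<open>x'\<close> in \<open>M\<close>
    rounds after a rewarded profile; player 2 gets \<open>v\<close> per round either way. Up to
    constants this is the bonus game.\<close>
  define xs where "xs i j = replicate M (if G i j then (p1, p2) else (p1', p2'))" for i j
  have 1: "u1 i j + (\<Sum>(s1, s2)\<leftarrow>xs i j. mixed_payoff u1 s1 s2)
      = u1 i j + real M * (x - x') * of_bool (G i j) + real M * x'" for i j
    by (simp add: xs_def sum_list_replicate p p' algebra_simps)
  have 2: "u2 i j + (\<Sum>(s1, s2)\<leftarrow>xs i j. mixed_payoff u2 s1 s2) = u2 i j + real M * v" for i j
    by (simp add: xs_def sum_list_replicate v)
  show ?thesis
  proof (rule SPE_from_continuation_lists[OF _ _ _ subopt])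
    show "length (xs i j) = M" for i j
      by (simp add: xs_def)
    show "stage_nash u1 u2 s1 s2" if "(s1, s2) \<in> set (xs i j)" for i j s1 s2
      using that p p' by (auto simp: xs_def split: if_splits)
    show "stage_nash
        (\<lambda>i j. u1 i j + (\<Sum>(s1, s2)\<leftarrow>xs i j. mixed_payoff u1 s1 s2))
        (\<lambda>i j. u2 i j + (\<Sum>(s1, s2)\<leftarrow>xs i j. mixed_payoff u2 s1 s2)) \<sigma>1 \<sigma>2"
      unfolding 1 2 stage_nash_add_const by (rule nash)
  qed
qed

text \<open>The bonus game comes from the transposed game, hence the reversed arguments of
  \<open>G\<close>.\<close>

lemma SPE_value2_varies:
  fixes u1 u2 :: "'a::finite \<Rightarrow> 'b::finite \<Rightarrow> real"
  assumes y: "y \<in> nash_values u1 u2 u2" "y' \<in> nash_values u1 u2 u2" "y' < y"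
    and val: "nash_values u1 u2 u1 = {v}"
    and dev: "mixed_payoff u2 s1 s2 < mixed_payoff u2 s1 (return_pmf b')"
    and br: "\<And>s. mixed_payoff u1 s s2 \<le> mixed_payoff u1 s1 s2"
  shows "\<exists>T m1 m2. T \<ge> 1 \<and> is_SPE u1 u2 T m1 m2 \<and> locally_suboptimal u1 u2 T m1 m2"
proof -
  note flip = mixed_payoff_flip[of u1] mixed_payoff_flip[of u2]
  have "nash_values (\<lambda>b a. u2 a b) (\<lambda>b a. u1 a b) (\<lambda>b a. u1 a b) = {v}"
    using val nash_values_flip[of u2 u1 u1] by simp
  then obtain D0 where D0: "\<And>D. D0 \<le> D \<Longrightarrow> \<exists>G \<sigma>2 \<sigma>1.
      stage_nash (\<lambda>b a. u2 a b + D * of_bool (G b a)) (\<lambda>b a. u1 a b) \<sigma>2 \<sigma>1 \<and>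
      \<not> stage_nash (\<lambda>b a. u2 a b) (\<lambda>b a. u1 a b) \<sigma>2 \<sigma>1"
    by (rule suboptimal_bonus_equilibrium[where ?s1.0 = s2 and ?s2.0 = s1 and a' = b'])
      (use dev br in \<open>auto simp: flip\<close>)
  obtain M where "D0 \<le> real M * (y - y')"
    using ex_large_multiple[of "y - y'"] y by auto
  with D0 obtain G \<sigma>1 \<sigma>2 where
    nash': "stage_nash (\<lambda>b a. u2 a b + real M * (y - y') * of_bool (G b a)) (\<lambda>b a. u1 a b) \<sigma>2 \<sigma>1"
    and subopt': "\<not> stage_nash (\<lambda>b a. u2 a b) (\<lambda>b a. u1 a b) \<sigma>2 \<sigma>1" by blast
  have nash: "stage_nash u1 (\<lambda>a b. u2 a b + real M * (y - y') * of_bool (G b a)) \<sigma>1 \<sigma>2"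
    using nash' stage_nash_flip[of "\<lambda>a b. u2 a b + real M * (y - y') * of_bool (G b a)" u1] by simp
  have subopt: "\<not> stage_nash u1 u2 \<sigma>1 \<sigma>2"
    using subopt' stage_nash_flip[of u2 u1] by simp
  obtain p1 p2 where p: "stage_nash u1 u2 p1 p2" "mixed_payoff u2 p1 p2 = y"
    using y unfolding nash_values_def by auto
  obtain p1' p2' where p': "stage_nash u1 u2 p1' p2'" "mixed_payoff u2 p1' p2' = y'"
    using y unfolding nash_values_def by auto
  have v: "mixed_payoff u1 p1 p2 = v" "mixed_payoff u1 p1' p2' = v"
    using val p(1) p'(1) by (auto simp: nash_values_def)
  define xs where "xs i j = replicate M (if G j i then (p1, p2) else (p1', p2'))" for i j
  have 1: "u1 i j + (\<Sum>(s1, s2)\<leftarrow>xs i j. mixed_payoff u1 s1 s2) = u1 i j + real M * v" for i j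
    by (simp add: xs_def sum_list_replicate v)
  have 2: "u2 i j + (\<Sum>(s1, s2)\<leftarrow>xs i j. mixed_payoff u2 s1 s2)
      = u2 i j + real M * (y - y') * of_bool (G j i) + real M * y'" for i j
    by (simp add: xs_def sum_list_replicate p p' algebra_simps)
  show ?thesis
  proof (rule SPE_from_continuation_lists[OF _ _ _ subopt])
    show "length (xs i j) = M" for i j
      by (simp add: xs_def)
    show "stage_nash u1 u2 s1 s2" if "(s1, s2) \<in> set (xs i j)" for i j s1 s2
      using that p p' by (auto simp: xs_def split: if_splits)
    show "stage_nash
        (\<lambda>i j. u1 i j + (\<Sum>(s1, s2)\<leftarrow>xs i j. mixed_payoff u1 s1 s2))
        (\<lambda>i j. u2 i j + (\<Sum>(s1, s2)\<leftarrow>xs i j. mixed_payoff u2 s1 s2)) \<sigma>1 \<sigma>2"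
      unfolding 1 2 stage_nash_add_const by (rule nash)
  qed
qed

section \<open>Both directions of the characterization\<close>

theorem mainTheorem4:
  fixes u1 u2 :: "'a::finite \<Rightarrow> 'b::finite \<Rightarrow> real"
  shows "(\<exists>T m1 m2. T \<ge> 1 \<and> is_SPE u1 u2 T m1 m2 \<and> locally_suboptimal u1 u2 T m1 m2)
    \<longleftrightarrow>
    ((\<exists>x\<in>nash_values u1 u2 u1. \<exists>y\<in>nash_values u1 u2 u1. x \<noteq> y) \<and>
     (\<exists>x\<in>nash_values u1 u2 u2. \<exists>y\<in>nash_values u1 u2 u2. x \<noteq> y) \<and>
     (\<exists>s1 s2. \<not> stage_nash u1 u2 s1 s2))
    \<or>
    ((\<exists>x\<in>nash_values u1 u2 u1. \<exists>y\<in>nash_values u1 u2 u1. x \<noteq> y) \<and>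
     (\<exists>v. nash_values u1 u2 u2 = {v}) \<and>
     (\<exists>s1 s2 a1'. mixed_payoff u1 s1 s2 < mixed_payoff u1 (return_pmf a1') s2 \<and>
        (\<forall>s2'. mixed_payoff u2 s1 s2' \<le> mixed_payoff u2 s1 s2)))
    \<or>
    ((\<exists>v. nash_values u1 u2 u1 = {v}) \<and>
     (\<exists>x\<in>nash_values u1 u2 u2. \<exists>y\<in>nash_values u1 u2 u2. x \<noteq> y) \<and>
     (\<exists>s1 s2 a2'. mixed_payoff u2 s1 s2 < mixed_payoff u2 s1 (return_pmf a2') \<and>
        (\<forall>s1'. mixed_payoff u1 s1' s2 \<le> mixed_payoff u1 s1 s2)))"
  (is "?L \<longleftrightarrow> ?C1 \<or> ?C2 \<or> ?C3")
proof
  assume ?L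
  then obtain T m1 m2 h where spe: "is_SPE u1 u2 T m1 m2"
    and h: "length h < T" "\<not> stage_nash u1 u2 (m1 h) (m2 h)"
    unfolding locally_suboptimal_def by blast
  \<comment> \<open>Suboptimal play refutes the hypothesis \<open>stage\<close> of
    \<open>SPE_all_stage_nash\<close>: in some non-Nash profile every player with a unique value
    best-responds.\<close>
  have "\<not> (\<forall>s1 s2.
      ((\<exists>v. nash_values u1 u2 u1 = {v}) \<longrightarrow> (\<forall>s. mixed_payoff u1 s s2 \<le> mixed_payoff u1 s1 s2)) \<longrightarrow>
      ((\<exists>v. nash_values u1 u2 u2 = {v}) \<longrightarrow> (\<forall>s. mixed_payoff u2 s1 s \<le> mixed_payoff u2 s1 s2)) \<longrightarrow>
      stage_nash u1 u2 s1 s2)"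
    using SPE_all_stage_nash[OF spe _ h(1)] h(2) by blast
  then obtain s1 s2 where not_nash: "\<not> stage_nash u1 u2 s1 s2"
    and br1: "\<And>v. nash_values u1 u2 u1 = {v} \<Longrightarrow> \<forall>s. mixed_payoff u1 s s2 \<le> mixed_payoff u1 s1 s2"
    and br2: "\<And>v. nash_values u1 u2 u2 = {v} \<Longrightarrow> \<forall>s. mixed_payoff u2 s1 s \<le> mixed_payoff u2 s1 s2"
    by blast
  show "?C1 \<or> ?C2 \<or> ?C3"
  proof (cases rule: nash_values_singleton_cases[of u1 u2 u1])
    case v: (1 v)
    show ?thesis
    proof (cases rule: nash_values_singleton_cases[of u1 u2 u2])
      case (1 v')
      then show ?thesis
        using br1[OF v] br2 not_nash unfolding stage_nash_def by blast
    next
      case (2 x y)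
      \<comment> \<open>Player 1 best-responds, so the profile fails to be Nash because of player 2,
        who then has a profitable pure deviation.\<close>
      obtain b where "mixed_payoff u2 s1 s2 < mixed_payoff u2 s1 (return_pmf b)"
        using not_nash br1[OF v] unfolding stage_nash_def
        by (meson mixed_payoff_le_pure2 not_le)
      moreover have "\<exists>x\<in>nash_values u1 u2 u2. \<exists>y\<in>nash_values u1 u2 u2. x \<noteq> y"
        using 2 by (intro bexI[of _ x] bexI[of _ y]) auto
      ultimately show ?thesis
        using v br1[OF v] by (intro disjI2) (intro conjI; blast)
    qed
  next
    case (2 x y)
    then have distinct1: "\<exists>x\<in>nash_values u1 u2 u1. \<exists>y\<in>nash_values u1 u2 u1. x \<noteq> y"
      by (intro bexI[of _ x] bexI[of _ y]) auto
    show ?thesis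
    proof (cases rule: nash_values_singleton_cases[of u1 u2 u2])
      case v: (1 v)
      obtain a where "mixed_payoff u1 s1 s2 < mixed_payoff u1 (return_pmf a) s2"
        using not_nash br2[OF v] unfolding stage_nash_def
        by (meson mixed_payoff_le_pure1 not_le)
      then show ?thesis
        using v br2[OF v] distinct1 by (intro disjI2 disjI1) (intro conjI; blast)
    next
      case (2 x' y')
      then have "\<exists>x\<in>nash_values u1 u2 u2. \<exists>y\<in>nash_values u1 u2 u2. x \<noteq> y"
        by (intro bexI[of _ x'] bexI[of _ y']) auto
      then show ?thesis
        using distinct1 not_nash by (intro disjI1) (intro conjI; blast)
    qed
  qed
next
  have ordered: "\<exists>x y. x \<in> A \<and> y \<in> A \<and> y < x" if "\<exists>x\<in>A. \<exists>y\<in>A. x \<noteq> y" for A :: "real set"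
    using that by (metis linorder_neqE_linordered_idom)
  assume "?C1 \<or> ?C2 \<or> ?C3"
  then show ?L
  proof (elim disjE conjE exE)
    fix s1 s2
    assume "\<exists>x\<in>nash_values u1 u2 u1. \<exists>y\<in>nash_values u1 u2 u1. x \<noteq> y"
      and "\<exists>x\<in>nash_values u1 u2 u2. \<exists>y\<in>nash_values u1 u2 u2. x \<noteq> y"
      and not_nash: "\<not> stage_nash u1 u2 s1 s2"
    from this(1,2)[THEN ordered] show ?L
      by (elim exE conjE) (rule SPE_both_values_vary[OF _ _ _ _ _ _ not_nash])
  next
    fix v s1 s2 a1'
    assume "\<exists>x\<in>nash_values u1 u2 u1. \<exists>y\<in>nash_values u1 u2 u1. x \<noteq> y"
      and val: "nash_values u1 u2 u2 = {v}"
      and dev: "mixed_payoff u1 s1 s2 < mixed_payoff u1 (return_pmf a1') s2"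
      and br: "\<forall>s2'. mixed_payoff u2 s1 s2' \<le> mixed_payoff u2 s1 s2"
    from this(1)[THEN ordered] show ?L
      by (elim exE conjE) (rule SPE_value1_varies[OF _ _ _ val dev spec[OF br]])
  next
    fix v s1 s2 a2'
    assume val: "nash_values u1 u2 u1 = {v}"
      and "\<exists>x\<in>nash_values u1 u2 u2. \<exists>y\<in>nash_values u1 u2 u2. x \<noteq> y"
      and dev: "mixed_payoff u2 s1 s2 < mixed_payoff u2 s1 (return_pmf a2')"
      and br: "\<forall>s1'. mixed_payoff u1 s1' s2 \<le> mixed_payoff u1 s1 s2"
    from this(2)[THEN ordered] show ?L
      by (elim exE conjE) (rule SPE_value2_varies[OF _ _ _ val dev spec[OF br]])
  qed
qed

end
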